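(* Let $f:\mathfrak{g}\twoheadrightarrow\mathfrak{q}$ be an extension of Leibniz algebras over $\mathbb{K}$ with $\mathfrak{n}=\ker(f)$. The following statements are equivalent: (a) $f:\mathfrak{g}\twoheadrightarrow\mathfrak{q}$ is a $\mathrm{Lie}$-trivial extension. (b) $\mathfrak{n}\cap\mathfrak{g}^{\mathrm{ann}}=0$. (c) The sequence $0\to\mathfrak{n}\to\mathfrak{g}_{\mathrm{Lie}}\to\mathfrak{q}_{\mathrm{Lie}}\to0$ is exact in the category of Lie algebras.
   Context: $\mathbb{K}$ is a field with $\frac12\in\mathbb{K}$. A Leibniz algebra is a $\mathbb{K}$-vector space $\mathfrak{q}$ with a bilinear bracket satisfying $[x,[y,z]]=[[x,y],z]-[[x,z],y]$. $\mathfrak{q}^{\mathrm{ann}}$ is the span of all $[x,x]$, $x\in\mathfrak{q}$ (a two-sided ideal), and $\mathfrak{q}_{\mathrm{Lie}}=\mathfrak{q}/\mathfrak{q}^{\mathrm{ann}}$ (a Lie algebra). An extension is a surjective homomorphism $f:\mathfrak{g}\twoheadrightarrow\mathfrak{q}$ of Leibniz algebras. It is $\mathrm{Lie}$-trivial if the square formed by $f$, the canonical projections $\mathfrak{g}\to\mathfrak{g}_{\mathrm{Lie}}$, $\mathfrak{q}\to\mathfrak{q}_{\mathrm{Lie}}$ and the induced map $\mathfrak{g}_{\mathrm{Lie}}\to\mathfrak{q}_{\mathrm{Lie}}$ is a pullback; equivalently, if $f$ induces (by restriction) an isomorphism $\mathfrak{g}^{\mathrm{ann}}\cong\mathfrak{q}^{\mathrm{ann}}$.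 In (c), $\mathfrak{n}\to\mathfrak{g}_{\mathrm{Lie}}$ is the composite $\mathfrak{n}\hookrightarrow\mathfrak{g}\twoheadrightarrow\mathfrak{g}_{\mathrm{Lie}}$ and $\mathfrak{g}_{\mathrm{Lie}}\to\mathfrak{q}_{\mathrm{Lie}}$ is induced by $f$. *)

theory Defs
  imports "HOL-Algebra.Module" "HOL-Algebra.QuotRing"
begin

section \<open>Leibniz and Lie algebras\<close>

text \<open>
  A Leibniz algebra over \<open>K\<close> is a \<open>module\<close> record whose multiplication \<open>x \<otimes> y\<close> is the bracket
  \<open>[x, y]\<close>. The field \<open>one\<close> of the record plays no role and is left unconstrained; the locale
  \<open>module\<close> imposes nothing on \<open>\<otimes>\<close> or \<open>\<one>\<close> of its second argument.
\<close>

locale leibniz_algebra = K?: field K + module K L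
  for K :: "('k, 'm) ring_scheme" and L :: "('k, 'a, 'n) module_scheme" (structure) +
  assumes bracket_closed [simp, intro]:
      "\<lbrakk>x \<in> carrier L; y \<in> carrier L\<rbrakk> \<Longrightarrow> x \<otimes> y \<in> carrier L"
    and bracket_add_left:
      "\<lbrakk>x \<in> carrier L; y \<in> carrier L; z \<in> carrier L\<rbrakk> \<Longrightarrow> (x \<oplus> y) \<otimes> z = x \<otimes> z \<oplus> y \<otimes> z"
    and bracket_add_right:
      "\<lbrakk>x \<in> carrier L; y \<in> carrier L; z \<in> carrier L\<rbrakk> \<Longrightarrow> x \<otimes> (y \<oplus> z) = x \<otimes> y \<oplus> x \<otimes> z"
    and bracket_smult_left:
      "\<lbrakk>c \<in> carrier K; x \<in> carrier L; y \<in> carrier L\<rbrakk> \<Longrightarrow> (c \<odot> x) \<otimes> y = c \<odot> (x \<otimes> y)"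
    and bracket_smult_right:
      "\<lbrakk>c \<in> carrier K; x \<in> carrier L; y \<in> carrier L\<rbrakk> \<Longrightarrow> x \<otimes> (c \<odot> y) = c \<odot> (x \<otimes> y)"
    and leibniz_identity:
      "\<lbrakk>x \<in> carrier L; y \<in> carrier L; z \<in> carrier L\<rbrakk>
        \<Longrightarrow> x \<otimes> (y \<otimes> z) = (x \<otimes> y) \<otimes> z \<ominus> (x \<otimes> z) \<otimes> y"

text \<open>For an alternating bracket the Leibniz identity is the Jacobi identity.\<close>

locale lie_algebra = leibniz_algebra K L
  for K :: "('k, 'm) ring_scheme" and L :: "('k, 'a, 'n) module_scheme" (structure) +
  assumes bracket_alternating: "x \<in> carrier L \<Longrightarrow> x \<otimes> x = \<zero>"

definition leibniz_hom ::
    "('k, 'm) ring_scheme \<Rightarrow> ('k, 'a, 'n) module_scheme \<Rightarrow> ('k, 'b, 'p) module_scheme \<Rightarrow> ('a \<Rightarrow> 'b) set"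
  where "leibniz_hom K L M =
    {f \<in> carrier L \<rightarrow> carrier M.
      (\<forall>x\<in>carrier L. \<forall>y\<in>carrier L. f (x \<oplus>\<^bsub>L\<^esub> y) = f x \<oplus>\<^bsub>M\<^esub> f y) \<and>
      (\<forall>c\<in>carrier K. \<forall>x\<in>carrier L. f (c \<odot>\<^bsub>L\<^esub> x) = c \<odot>\<^bsub>M\<^esub> f x) \<and>
      (\<forall>x\<in>carrier L. \<forall>y\<in>carrier L. f (x \<otimes>\<^bsub>L\<^esub> y) = f x \<otimes>\<^bsub>M\<^esub> f y)}"

definition leibniz_extension ::
    "('k, 'm) ring_scheme \<Rightarrow> ('k, 'a, 'n) module_scheme \<Rightarrow> ('k, 'b, 'p) module_scheme \<Rightarrow> ('a \<Rightarrow> 'b) \<Rightarrow> bool"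
  where "leibniz_extension K g q f \<longleftrightarrow>
    leibniz_algebra K g \<and> leibniz_algebra K q \<and> f \<in> leibniz_hom K g q \<and> f ` carrier g = carrier q"


section \<open>The Liezation\<close>

definition module_span ::
    "('k, 'm) ring_scheme \<Rightarrow> ('k, 'a, 'n) module_scheme \<Rightarrow> 'a set \<Rightarrow> 'a set"
  where "module_span K L S = \<Inter>{H. submodule H K L \<and> S \<subseteq> H}"

definition ann :: "('k, 'm) ring_scheme \<Rightarrow> ('k, 'a, 'n) module_scheme \<Rightarrow> 'a set"
  where "ann K L = module_span K L {x \<otimes>\<^bsub>L\<^esub> x | x. x \<in> carrier L}"

definition leibniz_quotient ::
    "('k, 'a, 'n) module_scheme \<Rightarrow> 'a set \<Rightarrow> ('k, 'a set) module"
  where "leibniz_quotient L I =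
    \<lparr>carrier = a_rcosets\<^bsub>L\<^esub> I, mult = rcoset_mult L I, one = I +>\<^bsub>L\<^esub> \<one>\<^bsub>L\<^esub>,
     zero = I, add = set_add L, smult = (\<lambda>c S. \<Union>x\<in>S. I +>\<^bsub>L\<^esub> (c \<odot>\<^bsub>L\<^esub> x))\<rparr>"

definition liezation ::
    "('k, 'm) ring_scheme \<Rightarrow> ('k, 'a, 'n) module_scheme \<Rightarrow> ('k, 'a set) module"
  where "liezation K L = leibniz_quotient L (ann K L)"

definition lie_proj ::
    "('k, 'm) ring_scheme \<Rightarrow> ('k, 'a, 'n) module_scheme \<Rightarrow> 'a \<Rightarrow> 'a set"
  where "lie_proj K L x = ann K L +>\<^bsub>L\<^esub> x"

text \<open>
  The map \<open>g\<^sub>L\<^sub>i\<^sub>e \<rightarrow> q\<^sub>L\<^sub>i\<^sub>e\<close> induced by \<open>f\<close>. The union does not depend on the representatives: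
  see \<open>lie_map_proj\<close> below.
\<close>

definition lie_map ::
    "('k, 'm) ring_scheme \<Rightarrow> ('k, 'b, 'p) module_scheme \<Rightarrow> ('a \<Rightarrow> 'b) \<Rightarrow> 'a set \<Rightarrow> 'b set"
  where "lie_map K q f S = (\<Union>x\<in>S. lie_proj K q (f x))"


section \<open>Pullback squares\<close>

definition fibre_product ::
    "('k, 'a, 'n) module_scheme \<Rightarrow> ('k, 'b, 'p) module_scheme \<Rightarrow> ('a \<Rightarrow> 'c) \<Rightarrow> ('b \<Rightarrow> 'c)
      \<Rightarrow> ('k, 'a \<times> 'b) module"
  where "fibre_product A B h k =
    \<lparr>carrier = {(a, b). a \<in> carrier A \<and> b \<in> carrier B \<and> h a = k b},
     mult = (\<lambda>(a, b) (a', b'). (a \<otimes>\<^bsub>A\<^esub> a', b \<otimes>\<^bsub>B\<^esub> b')),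
     one = (\<one>\<^bsub>A\<^esub>, \<one>\<^bsub>B\<^esub>),
     zero = (\<zero>\<^bsub>A\<^esub>, \<zero>\<^bsub>B\<^esub>),
     add = (\<lambda>(a, b) (a', b'). (a \<oplus>\<^bsub>A\<^esub> a', b \<oplus>\<^bsub>B\<^esub> b')),
     smult = (\<lambda>c (a, b). (c \<odot>\<^bsub>A\<^esub> a, c \<odot>\<^bsub>B\<^esub> b))\<rparr>"

text \<open>
  For the square with edges \<open>p\<^sub>1 : P \<rightarrow> A\<close>, \<open>p\<^sub>2 : P \<rightarrow> B\<close>, \<open>h : A \<rightarrow> C\<close>, \<open>k : B \<rightarrow> C\<close>, being a
  pullback means that \<open>x \<mapsto> (p\<^sub>1 x, p\<^sub>2 x)\<close> is an isomorphism onto \<open>A \<times>\<^sub>C B\<close>. The universal property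
  itself quantifies over test objects on all types and so cannot be the definiens; the lemmas
  \<open>pullback_square_universal\<close> and \<open>universal_pullback_square\<close> show that the two agree.
\<close>

definition pullback_square ::
    "('k, 'm) ring_scheme \<Rightarrow> ('k, 'd, 'r) module_scheme \<Rightarrow> ('k, 'a, 'n) module_scheme
      \<Rightarrow> ('k, 'b, 'p) module_scheme \<Rightarrow> ('d \<Rightarrow> 'a) \<Rightarrow> ('d \<Rightarrow> 'b) \<Rightarrow> ('a \<Rightarrow> 'c) \<Rightarrow> ('b \<Rightarrow> 'c) \<Rightarrow> bool"
  where "pullback_square K P A B p\<^sub>1 p\<^sub>2 h k \<longleftrightarrow>
    (\<lambda>x. (p\<^sub>1 x, p\<^sub>2 x)) \<in> leibniz_hom K P (fibre_product A B h k) \<and>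
    bij_betw (\<lambda>x. (p\<^sub>1 x, p\<^sub>2 x)) (carrier P) (carrier (fibre_product A B h k))"

definition lie_trivial ::
    "('k, 'm) ring_scheme \<Rightarrow> ('k, 'a, 'n) module_scheme \<Rightarrow> ('k, 'b, 'p) module_scheme \<Rightarrow> ('a \<Rightarrow> 'b) \<Rightarrow> bool"
  where "lie_trivial K g q f \<longleftrightarrow>
    pullback_square K g (liezation K g) q (lie_proj K g) f (lie_map K q f) (lie_proj K q)"


section \<open>Short exact sequences of Lie algebras\<close>

text \<open>\<open>0 \<rightarrow> A \<rightarrow> B \<rightarrow> C \<rightarrow> 0\<close> in the category of Lie algebras, so the objects have to be Lie algebras.\<close>

definition short_exact_lie ::
    "('k, 'm) ring_scheme \<Rightarrow> ('k, 'a, 'n) module_scheme \<Rightarrow> ('k, 'b, 'p) module_scheme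
      \<Rightarrow> ('k, 'c, 'r) module_scheme \<Rightarrow> ('a \<Rightarrow> 'b) \<Rightarrow> ('b \<Rightarrow> 'c) \<Rightarrow> bool"
  where "short_exact_lie K A B C i p \<longleftrightarrow>
    lie_algebra K A \<and> lie_algebra K B \<and> lie_algebra K C \<and>
    i \<in> leibniz_hom K A B \<and> p \<in> leibniz_hom K B C \<and>
    a_kernel A B i = {\<zero>\<^bsub>A\<^esub>} \<and> i ` carrier A = a_kernel B C p \<and> p ` carrier B = carrier C"


section \<open>The universal property of pullback squares\<close>

definition universal_square ::
    "'t itself \<Rightarrow> ('k, 'm) ring_scheme \<Rightarrow> ('k, 'd, 'r) module_scheme \<Rightarrow> ('k, 'a, 'n) module_scheme
      \<Rightarrow> ('k, 'b, 'p) module_scheme \<Rightarrow> ('d \<Rightarrow> 'a) \<Rightarrow> ('d \<Rightarrow> 'b) \<Rightarrow> ('a \<Rightarrow> 'c) \<Rightarrow> ('b \<Rightarrow> 'c) \<Rightarrow> bool"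
  where "universal_square (_ :: 't itself) K P A B p\<^sub>1 p\<^sub>2 h k \<longleftrightarrow>
    (\<forall>T :: ('k, 't) module. leibniz_algebra K T \<longrightarrow>
      (\<forall>s \<in> leibniz_hom K T A. \<forall>t \<in> leibniz_hom K T B.
        (\<forall>x\<in>carrier T. h (s x) = k (t x)) \<longrightarrow>
        (\<exists>u \<in> leibniz_hom K T P.
          (\<forall>x\<in>carrier T. p\<^sub>1 (u x) = s x \<and> p\<^sub>2 (u x) = t x) \<and>
          (\<forall>v \<in> leibniz_hom K T P. (\<forall>x\<in>carrier T. p\<^sub>1 (v x) = s x \<and> p\<^sub>2 (v x) = t x) \<longrightarrow>
            (\<forall>x\<in>carrier T. v x = u x)))))"

lemma leibniz_homD:
  assumes "f \<in> leibniz_hom K L M"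
  shows "x \<in> carrier L \<Longrightarrow> f x \<in> carrier M"
    and "\<lbrakk>x \<in> carrier L; y \<in> carrier L\<rbrakk> \<Longrightarrow> f (x \<oplus>\<^bsub>L\<^esub> y) = f x \<oplus>\<^bsub>M\<^esub> f y"
    and "\<lbrakk>c \<in> carrier K; x \<in> carrier L\<rbrakk> \<Longrightarrow> f (c \<odot>\<^bsub>L\<^esub> x) = c \<odot>\<^bsub>M\<^esub> f x"
    and "\<lbrakk>x \<in> carrier L; y \<in> carrier L\<rbrakk> \<Longrightarrow> f (x \<otimes>\<^bsub>L\<^esub> y) = f x \<otimes>\<^bsub>M\<^esub> f y"
  using assms by (auto simp: leibniz_hom_def)

lemma leibniz_homI:
  assumes "\<And>x. x \<in> carrier L \<Longrightarrow> f x \<in> carrier M"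
    and "\<And>x y. \<lbrakk>x \<in> carrier L; y \<in> carrier L\<rbrakk> \<Longrightarrow> f (x \<oplus>\<^bsub>L\<^esub> y) = f x \<oplus>\<^bsub>M\<^esub> f y"
    and "\<And>c x. \<lbrakk>c \<in> carrier K; x \<in> carrier L\<rbrakk> \<Longrightarrow> f (c \<odot>\<^bsub>L\<^esub> x) = c \<odot>\<^bsub>M\<^esub> f x"
    and "\<And>x y. \<lbrakk>x \<in> carrier L; y \<in> carrier L\<rbrakk> \<Longrightarrow> f (x \<otimes>\<^bsub>L\<^esub> y) = f x \<otimes>\<^bsub>M\<^esub> f y"
  shows "f \<in> leibniz_hom K L M"
  using assms by (auto simp: leibniz_hom_def)

lemma leibniz_hom_comp:
  assumes "f \<in> leibniz_hom K L M" "g \<in> leibniz_hom K M N"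
  shows "(\<lambda>x. g (f x)) \<in> leibniz_hom K L N"
  using assms by (intro leibniz_homI) (simp_all add: leibniz_homD)

lemma leibniz_hom_zero:
  assumes "leibniz_algebra K L" "leibniz_algebra K M" "f \<in> leibniz_hom K L M"
  shows "f \<zero>\<^bsub>L\<^esub> = \<zero>\<^bsub>M\<^esub>"
proof -
  interpret L: leibniz_algebra K L by fact
  interpret M: leibniz_algebra K M by fact
  have "f (\<zero>\<^bsub>K\<^esub> \<odot>\<^bsub>L\<^esub> \<zero>\<^bsub>L\<^esub>) = \<zero>\<^bsub>K\<^esub> \<odot>\<^bsub>M\<^esub> f \<zero>\<^bsub>L\<^esub>"
    by (simp add: leibniz_homD[OF assms(3)] del: L.smult_l_null L.smult_r_null M.smult_l_null)
  then show ?thesis using leibniz_homD(1)[OF assms(3), of "\<zero>\<^bsub>L\<^esub>"] by simp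
qed

lemma leibniz_hom_minus:
  assumes "leibniz_algebra K L" "leibniz_algebra K M" "f \<in> leibniz_hom K L M" "x \<in> carrier L"
  shows "f (\<ominus>\<^bsub>L\<^esub> x) = \<ominus>\<^bsub>M\<^esub> f x"
proof -
  interpret L: leibniz_algebra K L by fact
  interpret M: leibniz_algebra K M by fact
  have "f (\<ominus>\<^bsub>L\<^esub> x) \<oplus>\<^bsub>M\<^esub> f x = \<zero>\<^bsub>M\<^esub>"
    using assms leibniz_hom_zero[OF assms(1-3)] leibniz_homD(2)[OF assms(3), of "\<ominus>\<^bsub>L\<^esub> x" x]
    by (simp add: L.M.l_neg)
  then show ?thesis
    using assms by (simp add: M.M.minus_equality leibniz_homD(1))
qed

lemma (in module) module_span_submodule:
  assumes "S \<subseteq> carrier M"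
  shows "submodule (module_span R M S) R M"
proof (rule submoduleI)
  show "module_span R M S \<subseteq> carrier M"
    using assms carrier_is_submodule by (auto simp: module_span_def)
  show "\<zero>\<^bsub>M\<^esub> \<in> module_span R M S"
    by (auto simp: module_span_def dest!: submodule.axioms(1) dest: subgroup.one_closed)
qed (auto simp: module_span_def submoduleE)

lemma (in leibniz_algebra) ann_submodule: "submodule (ann K L) K L"
  unfolding ann_def by (rule module_span_submodule) auto

lemma (in leibniz_algebra) square_in_ann: "x \<in> carrier L \<Longrightarrow> x \<otimes> x \<in> ann K L"
  by (auto simp: ann_def module_span_def)

lemma hom_ann:
  assumes "leibniz_algebra K g" "leibniz_algebra K q" "f \<in> leibniz_hom K g q" "x \<in> ann K g"
  shows "f x \<in> ann K q"
proof -
  interpret g: leibniz_algebra K g by fact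
  interpret q: leibniz_algebra K q by fact
  note sub = q.submoduleE[OF q.ann_submodule]
  let ?H = "{x \<in> carrier g. f x \<in> ann K q}"
  have zero: "\<zero>\<^bsub>q\<^esub> \<in> ann K q"
    using q.ann_submodule by (auto dest!: submodule.axioms(1) dest: subgroup.one_closed)
  have "submodule ?H K g"
    using assms(3)
    by (intro g.submoduleI)
      (auto simp: leibniz_homD leibniz_hom_zero[OF assms(1-3)] leibniz_hom_minus[OF assms(1-3)]
        zero sub)
  moreover have "{x \<otimes>\<^bsub>g\<^esub> x | x. x \<in> carrier g} \<subseteq> ?H"
    by (auto simp: leibniz_homD[OF assms(3)] q.square_in_ann)
  ultimately show ?thesis
    using assms(4) by (auto simp: ann_def[of K g] module_span_def)
qed

lemma lie_map_proj:
  assumes "leibniz_algebra K g" "leibniz_algebra K q" "f \<in> leibniz_hom K g q" "x \<in> carrier g"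
  shows "lie_map K q f (lie_proj K g x) = lie_proj K q (f x)"
proof -
  interpret g: leibniz_algebra K g by fact
  interpret q: leibniz_algebra K q by fact
  have sg: "additive_subgroup (ann K g) g" "additive_subgroup (ann K q) q"
    using g.ann_submodule q.ann_submodule
    by (auto simp: submodule_def additive_subgroup_def)
  have ne: "lie_proj K g x \<noteq> {}"
    using sg(1)[THEN additive_subgroup.zero_closed] by (auto simp: lie_proj_def a_r_coset_def')
  have "lie_proj K q (f y) = lie_proj K q (f x)" if "y \<in> lie_proj K g x" for y
  proof -
    from that obtain a where a: "a \<in> ann K g" "y = a \<oplus>\<^bsub>g\<^esub> x"
      by (auto simp: lie_proj_def a_r_coset_def')
    have ac: "a \<in> carrier g" using additive_subgroup.a_Hcarr[OF sg(1) a(1)] .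
    have fa: "f a \<in> ann K q" using hom_ann[OF assms(1-3) a(1)] .
    have "f y = f a \<oplus>\<^bsub>q\<^esub> f x" using a(2) ac assms by (simp add: leibniz_homD)
    then have "f y \<in> ann K q +>\<^bsub>q\<^esub> f x" using fa by (auto simp: a_r_coset_def')
    from q.M.a_repr_independence[OF this leibniz_homD(1)[OF assms(3,4)]
        additive_subgroup.a_subgroup[OF sg(2)]]
    show ?thesis unfolding lie_proj_def by simp
  qed
  with ne show ?thesis unfolding lie_map_def by auto
qed

lemma pullback_square_universal:
  fixes K :: "('k, 'm) ring_scheme"
  assumes "leibniz_algebra K P" "leibniz_algebra K A" "leibniz_algebra K B"
    and "pullback_square K P A B p\<^sub>1 p\<^sub>2 h k"
  shows "universal_square TYPE('t) K P A B p\<^sub>1 p\<^sub>2 h k"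
proof -
  let ?F = "fibre_product A B h k" and ?c = "\<lambda>x. (p\<^sub>1 x, p\<^sub>2 x)"
  interpret P: leibniz_algebra K P by fact
  have c: "?c \<in> leibniz_hom K P ?F" and bij: "bij_betw ?c (carrier P) (carrier ?F)"
    using assms(4) by (auto simp: pullback_square_def)
  have inj: "x = y" if "x \<in> carrier P" "y \<in> carrier P" "p\<^sub>1 x = p\<^sub>1 y" "p\<^sub>2 x = p\<^sub>2 y" for x y
    using bij that by (auto simp: bij_betw_def inj_on_def)
  have p: "p\<^sub>1 \<in> leibniz_hom K P A" "p\<^sub>2 \<in> leibniz_hom K P B"
    using c by (auto simp: leibniz_hom_def fibre_product_def)
  show ?thesis
    unfolding universal_square_def
  proof (intro allI impI ballI)
    fix T :: "('k, 't) module" and s t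
    assume T: "leibniz_algebra K T" and s: "s \<in> leibniz_hom K T A" and t: "t \<in> leibniz_hom K T B"
      and st: "\<forall>x\<in>carrier T. h (s x) = k (t x)"
    interpret T: leibniz_algebra K T by fact
    define u where "u x = inv_into (carrier P) ?c (s x, t x)" for x
    have u: "u x \<in> carrier P" "p\<^sub>1 (u x) = s x" "p\<^sub>2 (u x) = t x" if "x \<in> carrier T" for x
    proof -
      have "(s x, t x) \<in> ?c ` carrier P"
        using that s t st bij by (auto simp: bij_betw_def fibre_product_def leibniz_homD)
      from inv_into_into[OF this] f_inv_into_f[OF this]
      show "u x \<in> carrier P" "p\<^sub>1 (u x) = s x" "p\<^sub>2 (u x) = t x" by (auto simp: u_def)
    qed
    have "u \<in> leibniz_hom K T P"
      using s t p by (intro leibniz_homI inj) (simp_all add: u leibniz_homD)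
    moreover have "\<forall>v \<in> leibniz_hom K T P.
        (\<forall>x\<in>carrier T. p\<^sub>1 (v x) = s x \<and> p\<^sub>2 (v x) = t x) \<longrightarrow> (\<forall>x\<in>carrier T. v x = u x)"
      by (auto intro!: inj simp: u leibniz_homD)
    ultimately show "\<exists>u\<in>leibniz_hom K T P. (\<forall>x\<in>carrier T. p\<^sub>1 (u x) = s x \<and> p\<^sub>2 (u x) = t x) \<and>
        (\<forall>v\<in>leibniz_hom K T P. (\<forall>x\<in>carrier T. p\<^sub>1 (v x) = s x \<and> p\<^sub>2 (v x) = t x) \<longrightarrow>
          (\<forall>x\<in>carrier T. v x = u x))"
      using u by blast
  qed
qed

lemma fibre_product_leibniz:
  assumes "leibniz_algebra K A" "leibniz_algebra K B" "leibniz_algebra K C"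
    and "h \<in> leibniz_hom K A C" "k \<in> leibniz_hom K B C"
  shows "leibniz_algebra K (fibre_product A B h k)"
proof -
  interpret A: leibniz_algebra K A by fact
  interpret B: leibniz_algebra K B by fact
  interpret C: leibniz_algebra K C by fact
  let ?F = "fibre_product A B h k"
  note hk = leibniz_homD[OF assms(4)] leibniz_homD[OF assms(5)]
    leibniz_hom_zero[OF assms(1,3,4)] leibniz_hom_zero[OF assms(2,3,5)]
    leibniz_hom_minus[OF assms(1,3,4)] leibniz_hom_minus[OF assms(2,3,5)]
  have ag: "abelian_group ?F"
  proof (rule abelian_groupI)
    fix x assume "x \<in> carrier ?F"
    then show "\<exists>y\<in>carrier ?F. y \<oplus>\<^bsub>?F\<^esub> x = \<zero>\<^bsub>?F\<^esub>"
      by (intro bexI[of _ "(\<ominus>\<^bsub>A\<^esub> fst x, \<ominus>\<^bsub>B\<^esub> snd x)"])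
        (auto simp: fibre_product_def hk A.M.l_neg B.M.l_neg)
  qed (auto simp: fibre_product_def hk A.M.a_ac B.M.a_ac)
  have inv: "\<ominus>\<^bsub>?F\<^esub> x = (\<ominus>\<^bsub>A\<^esub> fst x, \<ominus>\<^bsub>B\<^esub> snd x)" if "x \<in> carrier ?F" for x
    using that
    by (intro abelian_group.minus_equality[OF ag])
      (auto simp: fibre_product_def hk A.M.l_neg B.M.l_neg)
  have mod: "module K ?F"
    by (rule moduleI)
      (auto simp: fibre_product_def hk A.smult_l_distr B.smult_l_distr A.smult_r_distr
        B.smult_r_distr A.smult_assoc1 B.smult_assoc1 A.K.is_cring ag[unfolded fibre_product_def])
  show ?thesis
  proof (intro leibniz_algebra.intro leibniz_algebra_axioms.intro mod A.K.field_axioms)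
    fix x y z assume xyz: "x \<in> carrier ?F" "y \<in> carrier ?F" "z \<in> carrier ?F"
    have "x \<otimes>\<^bsub>?F\<^esub> z \<otimes>\<^bsub>?F\<^esub> y \<in> carrier ?F"
      using xyz by (auto simp: fibre_product_def hk)
    from inv[OF this] xyz
    show "x \<otimes>\<^bsub>?F\<^esub> (y \<otimes>\<^bsub>?F\<^esub> z) = x \<otimes>\<^bsub>?F\<^esub> y \<otimes>\<^bsub>?F\<^esub> z \<ominus>\<^bsub>?F\<^esub> x \<otimes>\<^bsub>?F\<^esub> z \<otimes>\<^bsub>?F\<^esub> y"
      by (auto simp: a_minus_def fibre_product_def A.leibniz_identity B.leibniz_identity)
  qed (auto simp: fibre_product_def hk A.bracket_add_left B.bracket_add_left
      A.bracket_add_right B.bracket_add_right A.bracket_smult_left B.bracket_smult_left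
      A.bracket_smult_right B.bracket_smult_right)
qed

lemma universal_pullback_square:
  fixes P :: "('k, 'd, 'r) module_scheme" and A :: "('k, 'a, 'n) module_scheme"
    and B :: "('k, 'b, 'p) module_scheme"
  assumes alg: "leibniz_algebra K P" "leibniz_algebra K A" "leibniz_algebra K B"
      "leibniz_algebra K C"
    and hom: "p\<^sub>1 \<in> leibniz_hom K P A" "p\<^sub>2 \<in> leibniz_hom K P B"
      "h \<in> leibniz_hom K A C" "k \<in> leibniz_hom K B C"
    and comm: "\<And>x. x \<in> carrier P \<Longrightarrow> h (p\<^sub>1 x) = k (p\<^sub>2 x)"
    and univ: "universal_square TYPE('a \<times> 'b) K P A B p\<^sub>1 p\<^sub>2 h k"
      "universal_square TYPE('d) K P A B p\<^sub>1 p\<^sub>2 h k"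
  shows "pullback_square K P A B p\<^sub>1 p\<^sub>2 h k"
proof -
  let ?F = "fibre_product A B h k" and ?c = "\<lambda>x. (p\<^sub>1 x, p\<^sub>2 x)"
  interpret P: leibniz_algebra K P by fact
  have F: "leibniz_algebra K ?F" by (rule fibre_product_leibniz) fact+
  have c: "?c \<in> leibniz_hom K P ?F"
    using hom by (intro leibniz_homI) (auto simp: fibre_product_def leibniz_homD comm)
  have "fst \<in> leibniz_hom K ?F A" "snd \<in> leibniz_hom K ?F B"
    by (auto simp: leibniz_hom_def fibre_product_def)
  moreover have "\<forall>x\<in>carrier ?F. h (fst x) = k (snd x)" by (auto simp: fibre_product_def)
  ultimately obtain u where u: "u \<in> leibniz_hom K ?F P"
      "\<And>x. x \<in> carrier ?F \<Longrightarrow> p\<^sub>1 (u x) = fst x \<and> p\<^sub>2 (u x) = snd x"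
    using univ(1) F unfolding universal_square_def by blast
  let ?P = "\<lparr>carrier = carrier P, mult = mult P, one = one P, zero = zero P, add = add P,
    smult = smult P\<rparr>"
  have ag: "abelian_group ?P"
    by (rule abelian_groupI) (auto simp: P.M.a_ac intro: P.M.l_neg)
  have inv: "\<ominus>\<^bsub>?P\<^esub> x = \<ominus>\<^bsub>P\<^esub> x" if "x \<in> carrier P" for x
    using that
    by (intro abelian_group.minus_equality[OF ag]) (auto simp: P.M.l_neg)
  have P': "leibniz_algebra K ?P"
    by (intro leibniz_algebra.intro leibniz_algebra_axioms.intro moduleI P.K.field_axioms ag)
      (auto simp: P.smult_l_distr P.smult_r_distr P.smult_assoc1 P.K.is_cring a_minus_def inv
        P.bracket_add_left P.bracket_add_right P.bracket_smult_left P.bracket_smult_right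
        P.leibniz_identity)
  have hom': "p\<^sub>1 \<in> leibniz_hom K ?P A" "p\<^sub>2 \<in> leibniz_hom K ?P B"
      "(\<lambda>x. x) \<in> leibniz_hom K ?P P" "?c \<in> leibniz_hom K ?P ?F"
    using hom c by (auto simp: leibniz_hom_def)
  have comm': "\<forall>x\<in>carrier ?P. h (p\<^sub>1 x) = k (p\<^sub>2 x)"
    using comm by simp
  obtain w where "\<forall>v \<in> leibniz_hom K ?P P.
      (\<forall>x\<in>carrier ?P. p\<^sub>1 (v x) = p\<^sub>1 x \<and> p\<^sub>2 (v x) = p\<^sub>2 x) \<longrightarrow> (\<forall>x\<in>carrier ?P. v x = w x)"
    using univ(2)[unfolded universal_square_def, rule_format, OF P' hom'(1,2)] comm' by blast
  then have w: "v x = w x" if "v \<in> leibniz_hom K ?P P"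
      "\<And>x. x \<in> carrier P \<Longrightarrow> p\<^sub>1 (v x) = p\<^sub>1 x \<and> p\<^sub>2 (v x) = p\<^sub>2 x" "x \<in> carrier P" for v x
    using that by simp
  have uc: "u (?c x) = x" if "x \<in> carrier P" for x
  proof -
    have "u (?c x) = w x"
      using u leibniz_homD(1)[OF c] that
      by (intro w[of "\<lambda>x. u (?c x)"] leibniz_hom_comp[OF hom'(4)]) auto
    also have "\<dots> = x" using w[OF hom'(3)] that by simp
    finally show ?thesis .
  qed
  have "bij_betw ?c (carrier P) (carrier ?F)"
    using uc u leibniz_homD(1)[OF c] leibniz_homD(1)[OF u(1)]
    by (intro bij_betw_byWitness[where f' = u]) (auto simp del: split_paired_All)
  with c show ?thesis by (simp add: pullback_square_def)
qed

end

theory Submission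
  imports Defs
begin

text \<open>
  Write \<open>n\<close> for the kernel of \<open>f : g \<rightarrow> q\<close>. Each of the two categorical conditions asks for several
  things at once, and for every extension all but one of them come for free.

  The reason is that a surjective \<open>f\<close> maps \<open>ann g\<close> \<^emph>\<open>onto\<close> \<open>ann q\<close> (\<open>image_ann\<close>): the squares of
  \<open>q\<close> are images of squares of \<open>g\<close>. Consequently an element of \<open>g\<close> that \<open>f\<close> sends into \<open>ann q\<close> can
  be corrected by an element of \<open>ann g\<close> so that it lies in \<open>n\<close>. This one correction gives both that
  the comparison map \<open>g \<rightarrow> g\<^sub>L\<^sub>i\<^sub>e \<times> q\<close> into the fibre product over \<open>q\<^sub>L\<^sub>i\<^sub>e\<close> is onto
  (\<open>comparison_surjective\<close>) and that \<open>n \<rightarrow> g\<^sub>L\<^sub>i\<^sub>e \<rightarrow> q\<^sub>L\<^sub>i\<^sub>e\<close> is exact in the middle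
  (\<open>kernel_lie_map\<close>).

  What is left in (a) is injectivity of \<open>x \<mapsto> (x + ann g, f x)\<close>, and what is left in (c) is
  injectivity of \<open>n \<rightarrow> g\<^sub>L\<^sub>i\<^sub>e\<close>. Both maps have the kernel \<open>n \<inter> ann g\<close>, so both conditions amount
  to (b). For (c) the objects must moreover be Lie algebras: \<open>g\<^sub>L\<^sub>i\<^sub>e\<close> and \<open>q\<^sub>L\<^sub>i\<^sub>e\<close> always are, and
  \<open>n\<close> is one under (b), since its squares lie in \<open>n \<inter> ann g\<close>.
\<close>

section \<open>Bilinearity and subalgebras\<close>

context leibniz_algebra
begin

lemma bracket_zero_right [simp]:
  assumes "x \<in> carrier L"
  shows "x \<otimes> \<zero> = \<zero>"
  using bracket_smult_right[of "\<zero>\<^bsub>K\<^esub>" x \<zero>] assms by simp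

lemma bracket_minus_right:
  assumes "x \<in> carrier L" "y \<in> carrier L"
  shows "x \<otimes> (\<ominus> y) = \<ominus> (x \<otimes> y)"
proof -
  have "x \<otimes> (\<ominus> y) \<oplus> x \<otimes> y = \<zero>"
    using assms bracket_add_right[of x "\<ominus> y" y] by (simp add: M.l_neg)
  then show ?thesis using assms by (simp add: M.minus_equality)
qed

lemma submodule_abelian_subgroup:
  assumes "submodule H K L"
  shows "abelian_subgroup H L"
  using assms by (intro abelian_subgroupI3 M.abelian_group_axioms)
    (auto simp: submodule_def additive_subgroup_def)

lemma zero_in_submodule:
  assumes "submodule H K L"
  shows "\<zero> \<in> H"
  using additive_subgroup.zero_closed abelian_subgroup.axioms(1)
    submodule_abelian_subgroup[OF assms] by blast

lemma subalgebra_leibniz: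
  assumes H: "submodule H K L" and closed: "\<And>x y. x \<in> H \<Longrightarrow> y \<in> H \<Longrightarrow> x \<otimes> y \<in> H"
  shows "leibniz_algebra K (L\<lparr>carrier := H\<rparr>)"
proof -
  let ?H = "L\<lparr>carrier := H\<rparr>"
  note sub = submoduleE[OF H]
  have in_L: "x \<in> carrier L" if "x \<in> H" for x using sub(1) that by blast
  have mod: "module K ?H"
    using submodule.submodule_is_module[OF H] module_axioms by blast
  have inv: "\<ominus>\<^bsub>?H\<^esub> x = \<ominus> x" if "x \<in> H" for x
    using that by (intro abelian_group.minus_equality[OF module.axioms(2)[OF mod]])
      (auto simp: sub(3) in_L M.l_neg)
  show ?thesis
    by (intro leibniz_algebra.intro leibniz_algebra_axioms.intro mod K.field_axioms)
      (auto simp: closed in_L bracket_add_left bracket_add_right bracket_smult_left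
        bracket_smult_right leibniz_identity a_minus_def inv)
qed

end

section \<open>Images and kernels of homomorphisms\<close>

text \<open>
  The axioms are identities, so they pass to surjective images. Since \<open>M\<close> is only assumed
  to carry operations, this yields the algebra structure on quotients.
\<close>

lemma surjective_image_leibniz:
  assumes L: "leibniz_algebra K L"
    and p: "p \<in> leibniz_hom K L M" and onto: "p ` carrier L = carrier M"
    and zero: "p \<zero>\<^bsub>L\<^esub> = \<zero>\<^bsub>M\<^esub>"
  shows "leibniz_algebra K M"
proof -
  interpret L: leibniz_algebra K L by fact
  note hom = leibniz_homD(2-4)[OF p, symmetric] zero[symmetric]
  have ag: "abelian_group M"
  proof (rule abelian_groupI)
    fix y assume "y \<in> carrier M"
    then obtain x where x: "x \<in> carrier L" "y = p x" using onto by blast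
    then have "p (\<ominus>\<^bsub>L\<^esub> x) \<oplus>\<^bsub>M\<^esub> y = \<zero>\<^bsub>M\<^esub>" by (simp add: hom L.M.l_neg)
    then show "\<exists>z\<in>carrier M. z \<oplus>\<^bsub>M\<^esub> y = \<zero>\<^bsub>M\<^esub>"
      using x leibniz_homD(1)[OF p] by blast
  qed (auto simp: onto[symmetric] hom L.M.a_ac)
  have inv: "\<ominus>\<^bsub>M\<^esub> p x = p (\<ominus>\<^bsub>L\<^esub> x)" if "x \<in> carrier L" for x
    using that leibniz_homD(1)[OF p]
    by (intro abelian_group.minus_equality[OF ag]) (auto simp: hom L.M.l_neg)
  show ?thesis
    by (intro leibniz_algebra.intro leibniz_algebra_axioms.intro moduleI ag L.K.field_axioms
        L.K.is_cring)
      (auto simp: onto[symmetric] hom inv a_minus_def L.smult_l_distr L.smult_r_distr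
        L.smult_assoc1 L.bracket_add_left L.bracket_add_right L.bracket_smult_left
        L.bracket_smult_right L.leibniz_identity)
qed

locale leibniz_morphism =
  L: leibniz_algebra K L + M: leibniz_algebra K M
  for K :: "('k, 'm) ring_scheme" and L :: "('k, 'a, 'n) module_scheme"
    and M :: "('k, 'b, 'p) module_scheme" +
  fixes f
  assumes hom: "f \<in> leibniz_hom K L M"
begin

lemmas map_simps = leibniz_homD[OF hom]
  leibniz_hom_zero[OF L.leibniz_algebra_axioms M.leibniz_algebra_axioms hom]
  leibniz_hom_minus[OF L.leibniz_algebra_axioms M.leibniz_algebra_axioms hom]

lemma image_submodule:
  assumes H: "submodule H K L"
  shows "submodule (f ` H) K M"
proof -
  note sub = L.submoduleE[OF H]
  have in_L: "x \<in> carrier L" if "x \<in> H" for x using sub(1) that by blast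
  show ?thesis
  proof (rule M.submoduleI)
    show "\<zero>\<^bsub>M\<^esub> \<in> f ` H"
      using imageI[OF L.zero_in_submodule[OF H], of f] by (simp add: map_simps)
  next
    fix a assume "a \<in> f ` H"
    then obtain x where "x \<in> H" "a = f x" by blast
    then show "\<ominus>\<^bsub>M\<^esub> a \<in> f ` H"
      using imageI[OF sub(3), of x f] in_L by (simp add: map_simps)
  next
    fix a b assume "a \<in> f ` H" "b \<in> f ` H"
    then obtain x y where "x \<in> H" "a = f x" "y \<in> H" "b = f y" by blast
    then show "a \<oplus>\<^bsub>M\<^esub> b \<in> f ` H"
      using imageI[OF sub(5), of x y f] in_L by (simp add: map_simps)
  next
    fix c a assume c: "c \<in> carrier K" and "a \<in> f ` H"
    then obtain x where "x \<in> H" "a = f x" by blast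
    then show "c \<odot>\<^bsub>M\<^esub> a \<in> f ` H"
      using imageI[OF sub(4), of c x f] c in_L by (simp add: map_simps)
  qed (use in_L map_simps(1) in auto)
qed

lemma mem_kernel_iff: "x \<in> a_kernel L M f \<longleftrightarrow> x \<in> carrier L \<and> f x = \<zero>\<^bsub>M\<^esub>"
  by (auto simp: a_kernel_def kernel_def)

lemma kernel_submodule: "submodule (a_kernel L M f) K L"
  by (rule L.submoduleI) (auto simp: mem_kernel_iff map_simps)

lemma kernel_leibniz: "leibniz_algebra K (L\<lparr>carrier := a_kernel L M f\<rparr>)"
  by (rule L.subalgebra_leibniz[OF kernel_submodule]) (auto simp: mem_kernel_iff map_simps)

lemma inj_on_iff_trivial_kernel: "inj_on f (carrier L) \<longleftrightarrow> a_kernel L M f = {\<zero>\<^bsub>L\<^esub>}"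
proof
  assume inj: "inj_on f (carrier L)"
  have "x = \<zero>\<^bsub>L\<^esub>" if "x \<in> a_kernel L M f" for x
    using that inj_onD[OF inj, of x "\<zero>\<^bsub>L\<^esub>"] by (simp add: mem_kernel_iff map_simps)
  then show "a_kernel L M f = {\<zero>\<^bsub>L\<^esub>}"
    using L.zero_in_submodule[OF kernel_submodule] by blast
next
  assume ker: "a_kernel L M f = {\<zero>\<^bsub>L\<^esub>}"
  show "inj_on f (carrier L)"
  proof (rule inj_onI)
    fix x y assume x: "x \<in> carrier L" and y: "y \<in> carrier L" and eq: "f x = f y"
    have "x \<oplus>\<^bsub>L\<^esub> \<ominus>\<^bsub>L\<^esub> y \<in> a_kernel L M f"
      using x y by (simp add: mem_kernel_iff map_simps eq M.M.r_neg)
    then have "x \<oplus>\<^bsub>L\<^esub> \<ominus>\<^bsub>L\<^esub> y = \<zero>\<^bsub>L\<^esub>" using ker by blast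
    then have "(x \<oplus>\<^bsub>L\<^esub> \<ominus>\<^bsub>L\<^esub> y) \<oplus>\<^bsub>L\<^esub> y = y" using y by simp
    then show "x = y" using x y by (simp add: L.M.a_assoc L.M.l_neg)
  qed
qed

end

section \<open>The annihilator and the Liezation\<close>

context leibniz_algebra
begin

lemma ann_carrier: "a \<in> ann K L \<Longrightarrow> a \<in> carrier L"
  using submoduleE(1)[OF ann_submodule] by blast

lemma ann_least:
  assumes "submodule H K L" "\<And>x. x \<in> carrier L \<Longrightarrow> x \<otimes> x \<in> H"
  shows "ann K L \<subseteq> H"
  using assms by (auto simp: ann_def module_span_def)

text \<open>For a square \<open>a = [y, y]\<close> the Leibniz identity reads \<open>[x, a] = [[x, y], y] - [[x, y], y]\<close>.\<close>

lemma bracket_ann_right: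
  assumes "x \<in> carrier L" "a \<in> ann K L"
  shows "x \<otimes> a = \<zero>"
proof -
  let ?H = "{a \<in> carrier L. x \<otimes> a = \<zero>}"
  have "submodule ?H K L"
    using assms(1)
    by (intro submoduleI)
      (auto simp: bracket_minus_right bracket_add_right bracket_smult_right)
  moreover have "y \<otimes> y \<in> ?H" if "y \<in> carrier L" for y
    using assms(1) that leibniz_identity[of x y y] by (simp add: a_minus_def M.r_neg)
  ultimately show ?thesis using ann_least[of ?H] assms(2) by blast
qed

text \<open>
  Polarising squares gives \<open>[a, x] + [x, a] \<in> ann L\<close>, and the second summand vanishes.
\<close>

lemma bracket_ann_left:
  assumes "x \<in> carrier L" "a \<in> ann K L"
  shows "a \<otimes> x \<in> ann K L"
proof -
  note sub = submoduleE[OF ann_submodule]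
  have a: "a \<in> carrier L" using assms(2) by (rule ann_carrier)
  have ax: "x \<otimes> a = \<zero>" "a \<otimes> a = \<zero>" using assms a bracket_ann_right by auto
  have "(a \<oplus> x) \<otimes> (a \<oplus> x) = a \<otimes> x \<oplus> x \<otimes> x"
    using a assms(1) ax by (simp add: bracket_add_left bracket_add_right)
  then have "a \<otimes> x = (a \<oplus> x) \<otimes> (a \<oplus> x) \<oplus> \<ominus> (x \<otimes> x)"
    using a assms(1) by (simp add: M.a_assoc M.r_neg)
  then show ?thesis using a assms(1) sub(3,5) square_in_ann by simp
qed

sublocale ann: abelian_subgroup "ann K L" L
  by (rule submodule_abelian_subgroup[OF ann_submodule])

lemma mem_lie_proj: "y \<in> lie_proj K L x \<longleftrightarrow> (\<exists>a\<in>ann K L. y = a \<oplus> x)"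
  by (auto simp: lie_proj_def a_r_coset_def')

lemma lie_proj_nonempty:
  assumes "x \<in> carrier L"
  shows "lie_proj K L x \<noteq> {}"
  using ann.a_rcos_self[OF assms] by (auto simp: lie_proj_def)

lemma lie_proj_add_ann:
  assumes "x \<in> carrier L" "a \<in> ann K L"
  shows "lie_proj K L (a \<oplus> x) = lie_proj K L x"
proof -
  have "a \<oplus> x \<in> ann K L +> x" using assms by (auto simp: a_r_coset_def')
  from M.a_repr_independence[OF this assms(1) ann.a_subgroup] show ?thesis
    by (simp add: lie_proj_def)
qed

lemma lie_proj_eq_iff:
  assumes "x \<in> carrier L" "y \<in> carrier L"
  shows "lie_proj K L x = lie_proj K L y \<longleftrightarrow> (\<exists>a\<in>ann K L. x = a \<oplus> y)"
  using assms ann.a_rcos_self[of x] lie_proj_add_ann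
  by (metis lie_proj_def mem_lie_proj)

text \<open>
  The operations of the quotient are unions over representatives; they descend because \<open>ann L\<close> is
  an ideal.
\<close>

lemma lie_proj_hom: "lie_proj K L \<in> leibniz_hom K L (liezation K L)"
proof (rule leibniz_homI)
  fix x assume "x \<in> carrier L"
  then show "lie_proj K L x \<in> carrier (liezation K L)"
    using M.a_rcosetsI[OF ann.a_subset]
    by (simp add: lie_proj_def liezation_def leibniz_quotient_def)
next
  fix x y assume "x \<in> carrier L" "y \<in> carrier L"
  then show "lie_proj K L (x \<oplus> y) = lie_proj K L x \<oplus>\<^bsub>liezation K L\<^esub> lie_proj K L y"
    by (simp add: lie_proj_def liezation_def leibniz_quotient_def ann.a_rcos_sum)
next
  fix c x assume c: "c \<in> carrier K" and x: "x \<in> carrier L"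
  have "lie_proj K L (c \<odot> y) = lie_proj K L (c \<odot> x)" if y: "y \<in> lie_proj K L x" for y
  proof -
    obtain a where a: "a \<in> ann K L" "y = a \<oplus> x" using y by (auto simp: mem_lie_proj)
    then have "c \<odot> y = c \<odot> a \<oplus> c \<odot> x"
      using smult_r_distr[OF c ann_carrier[OF a(1)] x] by simp
    then show ?thesis
      using lie_proj_add_ann[OF smult_closed[OF c x] submoduleE(4)[OF ann_submodule c a(1)]]
      by simp
  qed
  then have "(\<Union>y\<in>lie_proj K L x. lie_proj K L (c \<odot> y)) = lie_proj K L (c \<odot> x)"
    using lie_proj_nonempty[OF x] by (intro SUP_eq_const)
  then show "lie_proj K L (c \<odot> x) = c \<odot>\<^bsub>liezation K L\<^esub> lie_proj K L x"
    by (simp add: liezation_def leibniz_quotient_def lie_proj_def)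
next
  fix x y assume x: "x \<in> carrier L" and y: "y \<in> carrier L"
  have "lie_proj K L (x' \<otimes> y') = lie_proj K L (x \<otimes> y)"
    if x': "x' \<in> lie_proj K L x" and y': "y' \<in> lie_proj K L y" for x' y'
  proof -
    obtain a b where a: "a \<in> ann K L" "x' = a \<oplus> x" and b: "b \<in> ann K L" "y' = b \<oplus> y"
      using x' y' by (auto simp: mem_lie_proj)
    have "x' \<otimes> y' = a \<otimes> y \<oplus> x \<otimes> y"
      using a b x y by (simp add: ann_carrier bracket_add_left bracket_add_right
          bracket_ann_right)
    then show ?thesis using lie_proj_add_ann bracket_ann_left[OF y a(1)] x y by simp
  qed
  then have "(\<Union>x'\<in>lie_proj K L x. \<Union>y'\<in>lie_proj K L y. lie_proj K L (x' \<otimes> y')) =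
      lie_proj K L (x \<otimes> y)"
    using lie_proj_nonempty[OF x] lie_proj_nonempty[OF y] by (intro SUP_eq_const)
  then show "lie_proj K L (x \<otimes> y) = lie_proj K L x \<otimes>\<^bsub>liezation K L\<^esub> lie_proj K L y"
    by (simp add: liezation_def leibniz_quotient_def rcoset_mult_def lie_proj_def)
qed

lemma lie_proj_onto: "lie_proj K L ` carrier L = carrier (liezation K L)"
  unfolding liezation_def leibniz_quotient_def A_RCOSETS_def' partial_object.simps lie_proj_def
  by blast

lemma liezation_zero: "\<zero>\<^bsub>liezation K L\<^esub> = ann K L"
  by (simp add: liezation_def leibniz_quotient_def)

lemma lie_proj_eq_zero_iff:
  assumes "x \<in> carrier L"
  shows "lie_proj K L x = \<zero>\<^bsub>liezation K L\<^esub> \<longleftrightarrow> x \<in> ann K L"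
  unfolding lie_proj_def liezation_zero
  using M.a_coset_join1[OF _ assms ann.a_subgroup] M.a_coset_join2[OF assms ann.a_subgroup] by blast

lemma liezation_lie: "lie_algebra K (liezation K L)"
proof (intro lie_algebra.intro lie_algebra_axioms.intro)
  have "lie_proj K L \<zero> = \<zero>\<^bsub>liezation K L\<^esub>"
    using lie_proj_eq_zero_iff zero_in_submodule[OF ann_submodule] by blast
  then show "leibniz_algebra K (liezation K L)"
    by (rule surjective_image_leibniz[OF leibniz_algebra_axioms lie_proj_hom lie_proj_onto])
next
  fix X assume "X \<in> carrier (liezation K L)"
  then obtain x where x: "x \<in> carrier L" "X = lie_proj K L x" using lie_proj_onto by blast
  have "X \<otimes>\<^bsub>liezation K L\<^esub> X = lie_proj K L (x \<otimes> x)"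
    unfolding x(2) by (rule leibniz_homD(4)[OF lie_proj_hom x(1) x(1), symmetric])
  also have "\<dots> = \<zero>\<^bsub>liezation K L\<^esub>"
    using lie_proj_eq_zero_iff[OF bracket_closed[OF x(1) x(1)]] square_in_ann[OF x(1)] by blast
  finally show "X \<otimes>\<^bsub>liezation K L\<^esub> X = \<zero>\<^bsub>liezation K L\<^esub>" .
qed

end

section \<open>Extensions\<close>

locale leibniz_ext = leibniz_morphism K g q f
  for K :: "('k, 'm) ring_scheme" and g :: "('k, 'a, 'n) module_scheme"
    and q :: "('k, 'b, 'p) module_scheme" and f +
  assumes onto: "f ` carrier g = carrier q"
begin

lemma image_ann: "f ` ann K g = ann K q"
proof
  show "f ` ann K g \<subseteq> ann K q"
    using hom_ann[OF L.leibniz_algebra_axioms M.leibniz_algebra_axioms hom] by blast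
  show "ann K q \<subseteq> f ` ann K g"
  proof (rule M.ann_least[OF image_submodule[OF L.ann_submodule]])
    fix y assume "y \<in> carrier q"
    then obtain x where "x \<in> carrier g" "y = f x" using onto by blast
    then have "y \<otimes>\<^bsub>q\<^esub> y = f (x \<otimes>\<^bsub>g\<^esub> x)" "x \<otimes>\<^bsub>g\<^esub> x \<in> ann K g"
      by (simp_all add: map_simps L.square_in_ann)
    then show "y \<otimes>\<^bsub>q\<^esub> y \<in> f ` ann K g" by blast
  qed
qed

lemmas lie_map_lie_proj =
  lie_map_proj[OF L.leibniz_algebra_axioms M.leibniz_algebra_axioms hom]

text \<open>
  On representatives the induced map is \<open>f\<close> followed by the projection, which is a composite of
  homomorphisms.
\<close>

lemma lie_map_hom: "lie_map K q f \<in> leibniz_hom K (liezation K g) (liezation K q)"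
proof -
  note pg = leibniz_homD(2-4)[OF L.lie_proj_hom, symmetric]
  note pq = leibniz_homD[OF M.lie_proj_hom]
  have lift: "\<exists>x\<in>carrier g. X = lie_proj K g x" if "X \<in> carrier (liezation K g)" for X
    using that L.lie_proj_onto by blast
  show ?thesis
  proof (rule leibniz_homI)
    fix X assume "X \<in> carrier (liezation K g)"
    then obtain x where "x \<in> carrier g" "X = lie_proj K g x" using lift by blast
    then show "lie_map K q f X \<in> carrier (liezation K q)"
      by (simp add: lie_map_lie_proj map_simps pq)
  next
    fix X Y assume "X \<in> carrier (liezation K g)" "Y \<in> carrier (liezation K g)"
    then obtain x y where "x \<in> carrier g" "X = lie_proj K g x" "y \<in> carrier g" "Y = lie_proj K g y"
      using lift by metis
    then show "lie_map K q f (X \<oplus>\<^bsub>liezation K g\<^esub> Y) =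
          lie_map K q f X \<oplus>\<^bsub>liezation K q\<^esub> lie_map K q f Y"
        and "lie_map K q f (X \<otimes>\<^bsub>liezation K g\<^esub> Y) =
          lie_map K q f X \<otimes>\<^bsub>liezation K q\<^esub> lie_map K q f Y"
      by (simp_all add: pg lie_map_lie_proj map_simps pq)
  next
    fix c X assume "c \<in> carrier K" "X \<in> carrier (liezation K g)"
    moreover from this obtain x where "x \<in> carrier g" "X = lie_proj K g x" using lift by blast
    ultimately show "lie_map K q f (c \<odot>\<^bsub>liezation K g\<^esub> X) =
        c \<odot>\<^bsub>liezation K q\<^esub> lie_map K q f X"
      by (simp add: pg lie_map_lie_proj map_simps pq)
  qed
qed

lemma lie_map_onto: "lie_map K q f ` carrier (liezation K g) = carrier (liezation K q)"
proof -
  have "lie_map K q f ` lie_proj K g ` carrier g = lie_proj K q ` f ` carrier g"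
    by (simp add: image_image lie_map_lie_proj)
  then show ?thesis by (simp add: L.lie_proj_onto M.lie_proj_onto onto)
qed

text \<open>
  If \<open>f x\<close> and \<open>y\<close> agree modulo \<open>ann q\<close>, then lifting their difference to \<open>ann g\<close> moves \<open>x\<close> within
  its class to a preimage of \<open>y\<close>.
\<close>

lemma lift_within_class:
  assumes x: "x \<in> carrier g" and y: "y \<in> carrier q" and eq: "lie_proj K q (f x) = lie_proj K q y"
  obtains z where "z \<in> carrier g" "lie_proj K g z = lie_proj K g x" "f z = y"
proof -
  obtain b where b: "b \<in> ann K q" "y = b \<oplus>\<^bsub>q\<^esub> f x"
    using eq x y M.lie_proj_eq_iff[of y "f x"] by (metis map_simps(1))
  then obtain a where a: "a \<in> ann K g" "b = f a" using image_ann by blast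
  show thesis
  proof (rule that)
    show "a \<oplus>\<^bsub>g\<^esub> x \<in> carrier g" using a x by (simp add: L.ann_carrier)
    show "lie_proj K g (a \<oplus>\<^bsub>g\<^esub> x) = lie_proj K g x" using a x by (simp add: L.lie_proj_add_ann)
    show "f (a \<oplus>\<^bsub>g\<^esub> x) = y" using a b x by (simp add: L.ann_carrier map_simps)
  qed
qed

abbreviation comparison :: "'a \<Rightarrow> 'a set \<times> 'b"
  where "comparison x \<equiv> (lie_proj K g x, f x)"

abbreviation lie_fibre_product
  where "lie_fibre_product \<equiv> fibre_product (liezation K g) q (lie_map K q f) (lie_proj K q)"

lemma comparison_hom: "comparison \<in> leibniz_hom K g lie_fibre_product"
  by (intro leibniz_homI)
    (auto simp: fibre_product_def lie_map_lie_proj map_simps leibniz_homD[OF L.lie_proj_hom])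

lemma comparison_surjective: "comparison ` carrier g = carrier lie_fibre_product"
proof
  show "comparison ` carrier g \<subseteq> carrier lie_fibre_product"
    using leibniz_homD(1)[OF comparison_hom] by blast
  show "carrier lie_fibre_product \<subseteq> comparison ` carrier g"
  proof
    fix P assume "P \<in> carrier lie_fibre_product"
    then obtain x y where P: "P = (lie_proj K g x, y)" "x \<in> carrier g" "y \<in> carrier q"
        "lie_proj K q (f x) = lie_proj K q y"
      by (auto simp: fibre_product_def L.lie_proj_onto[symmetric] lie_map_lie_proj)
    then obtain z where "z \<in> carrier g" "lie_proj K g z = lie_proj K g x" "f z = y"
      using lift_within_class by blast
    then show "P \<in> comparison ` carrier g"
      unfolding P(1) by (intro image_eqI[of _ _ z]) simp_all
  qed
qed

lemma kernel_lie_map: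
  "a_kernel (liezation K g) (liezation K q) (lie_map K q f) = lie_proj K g ` a_kernel g q f"
proof -
  have zero: "lie_proj K q \<zero>\<^bsub>q\<^esub> = \<zero>\<^bsub>liezation K q\<^esub>"
    using M.lie_proj_eq_zero_iff[OF M.M.zero_closed] M.zero_in_submodule[OF M.ann_submodule] by blast
  show ?thesis
  proof (intro subset_antisym subsetI)
    fix X assume "X \<in> a_kernel (liezation K g) (liezation K q) (lie_map K q f)"
    then have X: "X \<in> carrier (liezation K g)" "lie_map K q f X = lie_proj K q \<zero>\<^bsub>q\<^esub>"
      unfolding zero by (simp_all add: a_kernel_def kernel_def)
    then obtain x where x: "x \<in> carrier g" "X = lie_proj K g x" using L.lie_proj_onto by blast
    then have "lie_proj K q (f x) = lie_proj K q \<zero>\<^bsub>q\<^esub>"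
      using X(2) lie_map_lie_proj[OF x(1)] by metis
    from lift_within_class[OF x(1) M.M.zero_closed this]
    obtain z where "z \<in> carrier g" "lie_proj K g z = lie_proj K g x" "f z = \<zero>\<^bsub>q\<^esub>" .
    then show "X \<in> lie_proj K g ` a_kernel g q f"
      unfolding x(2) by (intro image_eqI[of _ _ z]) (simp_all add: mem_kernel_iff)
  next
    fix X assume "X \<in> lie_proj K g ` a_kernel g q f"
    then obtain x where x: "x \<in> carrier g" "f x = \<zero>\<^bsub>q\<^esub>" "X = lie_proj K g x"
      by (auto simp: mem_kernel_iff)
    have "lie_map K q f X = \<zero>\<^bsub>liezation K q\<^esub>"
      unfolding x(3) lie_map_lie_proj[OF x(1)] x(2) by (rule zero)
    moreover have "X \<in> carrier (liezation K g)"
      unfolding x(3) by (rule leibniz_homD(1)[OF L.lie_proj_hom x(1)])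
    ultimately show "X \<in> a_kernel (liezation K g) (liezation K q) (lie_map K q f)"
      by (simp add: a_kernel_def kernel_def)
  qed
qed

text \<open>
  The fibre product is a Leibniz algebra, so injectivity of the comparison homomorphism can be read
  off its kernel; an element is killed by both components iff it lies in \<open>n \<inter> ann g\<close>.
\<close>

lemma lie_trivial_iff:
  "lie_trivial K g q f \<longleftrightarrow> a_kernel g q f \<inter> ann K g = {\<zero>\<^bsub>g\<^esub>}"
proof -
  have "leibniz_algebra K lie_fibre_product"
    using L.liezation_lie M.liezation_lie
    by (intro fibre_product_leibniz[OF _ M.leibniz_algebra_axioms _ lie_map_hom M.lie_proj_hom])
      (simp_all add: lie_algebra_def)
  then interpret comp: leibniz_morphism K g lie_fibre_product comparison
    using comparison_hom
    by (intro leibniz_morphism.intro leibniz_morphism_axioms.intro L.leibniz_algebra_axioms)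
  have "x \<in> a_kernel g lie_fibre_product comparison \<longleftrightarrow> x \<in> a_kernel g q f \<inter> ann K g" for x
  proof -
    have "comparison x = \<zero>\<^bsub>lie_fibre_product\<^esub> \<longleftrightarrow>
        lie_proj K g x = \<zero>\<^bsub>liezation K g\<^esub> \<and> f x = \<zero>\<^bsub>q\<^esub>"
      by (simp add: fibre_product_def)
    then show ?thesis
      using L.lie_proj_eq_zero_iff unfolding comp.mem_kernel_iff mem_kernel_iff Int_iff by blast
  qed
  then have "a_kernel g lie_fibre_product comparison = a_kernel g q f \<inter> ann K g" by blast
  then show ?thesis
    using comparison_hom comparison_surjective comp.inj_on_iff_trivial_kernel
    unfolding lie_trivial_def pullback_square_def bij_betw_def by simp
qed

text \<open>The square of an element of the ideal \<open>n\<close> lies in \<open>n\<close> and in \<open>ann g\<close>.\<close>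

lemma kernel_lie:
  assumes "a_kernel g q f \<inter> ann K g = {\<zero>\<^bsub>g\<^esub>}"
  shows "lie_algebra K (g\<lparr>carrier := a_kernel g q f\<rparr>)"
proof (intro lie_algebra.intro lie_algebra_axioms.intro kernel_leibniz)
  fix x assume "x \<in> carrier (g\<lparr>carrier := a_kernel g q f\<rparr>)"
  then have x: "x \<in> carrier g" "f x = \<zero>\<^bsub>q\<^esub>" by (simp_all add: mem_kernel_iff)
  then have "x \<otimes>\<^bsub>g\<^esub> x \<in> a_kernel g q f \<inter> ann K g"
    by (simp add: mem_kernel_iff map_simps L.square_in_ann)
  then show "x \<otimes>\<^bsub>g\<lparr>carrier := a_kernel g q f\<rparr>\<^esub> x = \<zero>\<^bsub>g\<lparr>carrier := a_kernel g q f\<rparr>\<^esub>"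
    using assms by simp
qed

text \<open>The only part of exactness that can fail is injectivity on \<open>n\<close>, apart from \<open>n\<close> being Lie.\<close>

lemma short_exact_iff:
  "short_exact_lie K (g\<lparr>carrier := a_kernel g q f\<rparr>) (liezation K g) (liezation K q)
      (lie_proj K g) (lie_map K q f) \<longleftrightarrow>
    a_kernel g q f \<inter> ann K g = {\<zero>\<^bsub>g\<^esub>}"
proof -
  let ?n = "g\<lparr>carrier := a_kernel g q f\<rparr>"
  have incl: "lie_proj K g \<in> leibniz_hom K ?n (liezation K g)"
    using L.lie_proj_hom by (auto simp: leibniz_hom_def mem_kernel_iff)
  have "a_kernel ?n (liezation K g) (lie_proj K g) = a_kernel g q f \<inter> ann K g"
    using L.lie_proj_eq_zero_iff mem_kernel_iff by (fastforce simp: a_kernel_def kernel_def)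
  then show ?thesis
    using kernel_lie incl lie_map_hom kernel_lie_map lie_map_onto L.liezation_lie M.liezation_lie
    unfolding short_exact_lie_def by simp blast
qed

end

theorem proposition3p7:
  fixes K :: "('k, 'm) ring_scheme"
    and g :: "('k, 'a, 'n) module_scheme"
    and q :: "('k, 'b, 'p) module_scheme"
    and f :: "'a \<Rightarrow> 'b"
  assumes "field K"
    and "\<one>\<^bsub>K\<^esub> \<oplus>\<^bsub>K\<^esub> \<one>\<^bsub>K\<^esub> \<in> Units K"
    and "leibniz_extension K g q f"
    and "n = a_kernel g q f"
  shows "(lie_trivial K g q f \<longleftrightarrow> n \<inter> ann K g = {\<zero>\<^bsub>g\<^esub>}) \<and>
         (n \<inter> ann K g = {\<zero>\<^bsub>g\<^esub>} \<longleftrightarrow>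
          short_exact_lie K (g\<lparr>carrier := n\<rparr>) (liezation K g) (liezation K q)
            (lie_proj K g) (lie_map K q f))"
proof -
  interpret leibniz_ext K g q f
    using assms(3) by (auto simp: leibniz_extension_def leibniz_ext_def leibniz_morphism_def
        leibniz_ext_axioms_def leibniz_morphism_axioms_def)
  show ?thesis using lie_trivial_iff short_exact_iff assms(4) by simp
qed

end
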